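(* Let $G$ be a group with finite symmetric generating set $X$. If $G$ has a normal form over $X^*$ which can be computed in logspace, then there is a constant $c$ such that the normal form for an input word of length $n$ has length $O(n^c)$.
   Context: For $w\in X^*$ let $\overline{w}\in G$ denote the element it represents. A normal form for $(G,X)$ is a subset $L\subseteq X^*$ such that $w\mapsto\overline{w}$ restricts to a bijection $L\to G$. The normal form for an input word $w\in X^*$ is the unique $f(w)\in L$ with $\overline{f(w)}=\overline{w}$; the normal form can be computed in logspace if the function $f:X^*\to X^*$ is logspace computable. A deterministic logspace transducer is a deterministic machine with a finite state control and three tapes: a read-only input tape storing the input word; a read-write work tape restricted to at most $c_0\log n$ squares, where $n$ is the length of the input word and $c_0$ is a fixed constant; and a write-only output tape written from left to right. In each transition it may modify the work tape, change state, move the input read-head, and write at most a fixed constant number of letters to the output tape. A function $f:X^*\to X^*$ is logspace computable if some deterministic logspace transducer outputs $f(w)$ on every input $w\in X^*$ ($X^*$ is the set of finite words over $X$, including the empty word). *)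

theory Defs
  imports "HOL-Algebra.Generated_Groups" "HOL-Library.Landau_Symbols" Complex_Main
begin

section \<open>Normal forms\<close>

definition word_eval :: "('a, 'b) monoid_scheme \<Rightarrow> 'a list \<Rightarrow> 'a" where
  "word_eval G w = foldr (\<otimes>\<^bsub>G\<^esub>) w \<one>\<^bsub>G\<^esub>"

definition normal_form :: "('a, 'b) monoid_scheme \<Rightarrow> 'a set \<Rightarrow> 'a list set \<Rightarrow> bool" where
  "normal_form G X L \<longleftrightarrow> L \<subseteq> lists X \<and> bij_betw (word_eval G) L (carrier G)"

definition normal_form_of :: "('a, 'b) monoid_scheme \<Rightarrow> 'a list set \<Rightarrow> 'a list \<Rightarrow> 'a list" where
  "normal_form_of G L w = (THE u. u \<in> L \<and> word_eval G u = word_eval G w)"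


section \<open>Deterministic logspace transducers\<close>

datatype move = Move_Left | Stay | Move_Right

datatype 'a input_cell = Left_End | Letter 'a | Right_End

text \<open>
  The transition function is partial, and the machine halts when it is undefined. A value
  \<open>Some (q', g', d, e, out)\<close> gives the new state, the symbol written on the scanned work
  square, the moves of the input head and of the work head, and the word appended to the
  output tape.
\<close>

record ('q, 'g, 'a) transducer =
  states :: "'q set"
  start_state :: 'q
  work_alphabet :: "'g set"
  blank_symbol :: 'g
  delta :: "'q \<Rightarrow> 'a input_cell \<Rightarrow> 'g \<Rightarrow> ('q \<times> 'g \<times> move \<times> move \<times> 'a list) option"

definition transducer_over :: "'a set \<Rightarrow> ('q, 'g, 'a) transducer \<Rightarrow> bool" where
  "transducer_over X M \<longleftrightarrow>
     finite (states M) \<and> start_state M \<in> states M \<and>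
     finite (work_alphabet M) \<and> blank_symbol M \<in> work_alphabet M \<and>
     (\<exists>k::nat. \<forall>q\<in>states M. \<forall>a\<in>{Left_End, Right_End} \<union> Letter ` X. \<forall>g\<in>work_alphabet M.
        \<forall>q' g' d e out. delta M q a g = Some (q', g', d, e, out) \<longrightarrow>
          q' \<in> states M \<and> g' \<in> work_alphabet M \<and> out \<in> lists X \<and> length out \<le> k)"

text \<open>
  On input \<open>w\<close> the letters of \<open>w\<close> occupy the positions \<open>1, \<dots>, length w\<close> of the input tape,
  between end markers at \<open>0\<close> and \<open>length w + 1\<close>. The input head does not leave this range, and
  the work tape is infinite to the right only: a move off either tape leaves the head in place.
\<close>

record ('q, 'g, 'a) config =
  state :: 'q
  input_pos :: nat
  work_pos :: nat
  work_tape :: "nat \<Rightarrow> 'g"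
  output_tape :: "'a list"

definition input_at :: "'a list \<Rightarrow> nat \<Rightarrow> 'a input_cell" where
  "input_at w i =
     (if i = 0 then Left_End else if i \<le> length w then Letter (w ! (i - 1)) else Right_End)"

fun move_head :: "move \<Rightarrow> nat \<Rightarrow> nat" where
  "move_head Move_Left i = i - 1"
| "move_head Stay i = i"
| "move_head Move_Right i = i + 1"

definition initial_config :: "('q, 'g, 'a) transducer \<Rightarrow> ('q, 'g, 'a) config" where
  "initial_config M =
     \<lparr>state = start_state M, input_pos = 1, work_pos = 0,
      work_tape = (\<lambda>_. blank_symbol M), output_tape = []\<rparr>"

definition next_config ::
  "('q, 'g, 'a) transducer \<Rightarrow> 'a list \<Rightarrow> ('q, 'g, 'a) config \<Rightarrow> ('q, 'g, 'a) config option" where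
  "next_config M w C =
     map_option
       (\<lambda>(q', g', d, e, out).
          \<lparr>state = q',
           input_pos = min (move_head d (input_pos C)) (length w + 1),
           work_pos = move_head e (work_pos C),
           work_tape = (work_tape C)(work_pos C := g'),
           output_tape = output_tape C @ out\<rparr>)
       (delta M (state C) (input_at w (input_pos C)) (work_tape C (work_pos C)))"

definition reachable ::
  "('q, 'g, 'a) transducer \<Rightarrow> 'a list \<Rightarrow> ('q, 'g, 'a) config \<Rightarrow> bool" where
  "reachable M w = (\<lambda>C D. next_config M w C = Some D)\<^sup>*\<^sup>* (initial_config M)"

definition outputs :: "('q, 'g, 'a) transducer \<Rightarrow> 'a list \<Rightarrow> 'a list \<Rightarrow> bool" where
  "outputs M w v \<longleftrightarrow> (\<exists>C. reachable M w C \<and> next_config M w C = None \<and> output_tape C = v)"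

text \<open>
  Only the squares \<open>0, \<dots>, m\<close> have been visited as long as the work head has not moved beyond
  square \<open>m\<close>. The work head always occupies a square, so one square is allowed even when
  \<open>c\<^sub>0 log n < 1\<close>, as is the case for \<open>n \<le> 1\<close>.
\<close>

definition runs_in_logspace :: "'a set \<Rightarrow> ('q, 'g, 'a) transducer \<Rightarrow> bool" where
  "runs_in_logspace X M \<longleftrightarrow>
     (\<exists>c\<^sub>0::real. \<forall>w\<in>lists X. \<forall>C. reachable M w C \<longrightarrow>
        real (work_pos C + 1) \<le> max 1 (c\<^sub>0 * log 2 (real (length w))))"

text \<open>
  States and work symbols form finite sets, so taking them to be natural numbers loses no
  generality.
\<close>

definition logspace_computable :: "'a set \<Rightarrow> ('a list \<Rightarrow> 'a list) \<Rightarrow> bool" where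
  "logspace_computable X f \<longleftrightarrow>
     (\<exists>M :: (nat, nat, 'a) transducer.
        transducer_over X M \<and> runs_in_logspace X M \<and> (\<forall>w\<in>lists X. outputs M w (f w)))"

end

theory Submission
  imports Defs
begin

text \<open>
  The values of any logspace computable function have polynomially bounded length, because a
  logspace machine halts after polynomially many steps. The machine never reads its output tape, so
  how it continues depends only on the state, the two head positions and the work tape.
  A deterministic computation that halts cannot pass twice through the same such data, since it
  would then loop. With \<open>s\<close> work squares available there are at most
  \<open>\<bar>Q\<bar> (n + 2) s \<bar>\<Gamma>\<bar>\<^sup>s\<close> possibilities for the data, and \<open>s = O(log n)\<close> makes this
  number polynomial in \<open>n\<close>. It bounds the number of steps, and hence, as each step writes a bounded
  number of letters, also the length of the output.

  Of the work tape only a finite initial segment, restricted to the available squares, is recorded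
  (\<open>visible_part\<close>); \<open>halting_run_visits_distinct_views\<close> is the pigeonhole argument,
  and \<open>two_power_log_le\<close> turns the exponential in \<open>s\<close> into a power of \<open>n\<close>.
\<close>

section \<open>Halting deterministic runs do not repeat\<close>

text \<open>
  If \<open>run i\<close> and \<open>run j\<close> with \<open>i < j\<close> looked alike, then so would \<open>run (i + d)\<close> and
  \<open>run (j + d)\<close> for all \<open>d\<close>. Hence \<open>run (i + (T - j))\<close> would halt like \<open>run T\<close>, although it
  comes earlier.
\<close>

lemma halting_run_visits_distinct_views:
  fixes step :: "'c \<Rightarrow> 'c option" and run :: "nat \<Rightarrow> 'c"
  assumes run: "\<And>i. i < T \<Longrightarrow> step (run i) = Some (run (Suc i))"
    and halt: "step (run T) = None"
    and respects: "\<And>i j. i \<le> T \<Longrightarrow> j \<le> T \<Longrightarrow> view (run i) = view (run j) \<Longrightarrow>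
      map_option view (step (run i)) = map_option view (step (run j))"
  shows "inj_on (\<lambda>i. view (run i)) {..T}"
proof (rule linorder_inj_onI)
  fix i j :: nat
  assume "i < j" and "j \<in> {..T}"
  then have "j \<le> T" by simp
  show "view (run i) \<noteq> view (run j)"
  proof
    assume same: "view (run i) = view (run j)"
    have "view (run (i + d)) = view (run (j + d))" if "j + d \<le> T" for d
      using that
    proof (induction d)
      case 0
      then show ?case using same by simp
    next
      case (Suc d)
      then have "map_option view (step (run (i + d))) = map_option view (step (run (j + d)))"
        using \<open>i < j\<close> by (intro respects) auto
      with Suc show ?case using run[of "i + d"] run[of "j + d"] \<open>i < j\<close> by simp
    qed
    from this[of "T - j"] have "view (run (i + (T - j))) = view (run T)"
      using \<open>j \<le> T\<close> by simp
    then have "map_option view (step (run (i + (T - j)))) = map_option view (step (run T))"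
      using \<open>i < j\<close> \<open>j \<le> T\<close> by (intro respects) auto
    moreover have "i + (T - j) < T"
      using \<open>i < j\<close> \<open>j \<le> T\<close> by linarith
    ultimately show False
      using halt by (simp only: run) simp
  qed
qed auto

section \<open>Output length in terms of the work space\<close>

text \<open>
  The output tape is left out because the machine does not read it, and the squares from \<open>s\<close>
  on because a machine confined to the first \<open>s\<close> squares does not reach them. What is left takes
  finitely many values.
\<close>

definition visible_part ::
  "nat \<Rightarrow> ('q, 'g, 'a) config \<Rightarrow> 'q \<times> nat \<times> nat \<times> (nat \<Rightarrow> 'g)" where
  "visible_part s C = (state C, input_pos C, work_pos C, restrict (work_tape C) {..<s})"

lemma next_config_respects_visible_part:
  assumes "visible_part s C = visible_part s D" and "work_pos C < s"
  shows "map_option (visible_part s) (next_config M w C) =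
    map_option (visible_part s) (next_config M w D)"
proof -
  have eqs: "state C = state D" "input_pos C = input_pos D" "work_pos C = work_pos D"
    and tapes: "restrict (work_tape C) {..<s} = restrict (work_tape D) {..<s}"
    using assms(1) by (auto simp: visible_part_def)
  have agree: "work_tape C i = work_tape D i" if "i < s" for i
    using fun_cong[OF tapes, of i] that by simp
  have scanned: "work_tape C (work_pos D) = work_tape D (work_pos D)"
    using agree assms(2) eqs by simp
  have "restrict ((work_tape C)(p := g)) {..<s} = restrict ((work_tape D)(p := g)) {..<s}" for p g
    using agree by (auto simp: restrict_def fun_eq_iff)
  then show ?thesis
    by (auto simp: next_config_def eqs scanned visible_part_def option.map_comp comp_def
        split: prod.splits intro!: option.map_cong)
qed

definition well_formed_config ::
  "('q, 'g, 'a) transducer \<Rightarrow> 'a list \<Rightarrow> ('q, 'g, 'a) config \<Rightarrow> bool" where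
  "well_formed_config M w C \<longleftrightarrow>
     state C \<in> states M \<and> input_pos C \<le> length w + 1 \<and> (\<forall>i. work_tape C i \<in> work_alphabet M)"

lemma input_at_in_cells:
  assumes "w \<in> lists X"
  shows "input_at w i \<in> {Left_End, Right_End} \<union> Letter ` X"
  using assms by (auto simp: input_at_def in_lists_conv_set)

lemma transducer_over_output_bound:
  assumes "transducer_over X M"
  shows "\<exists>k. \<forall>w C D. w \<in> lists X \<longrightarrow> well_formed_config M w C \<longrightarrow>
    next_config M w C = Some D \<longrightarrow>
    well_formed_config M w D \<and> length (output_tape D) \<le> length (output_tape C) + k"
proof -
  obtain k :: nat where k: "\<And>q a g q' g' d e out.
      q \<in> states M \<Longrightarrow> a \<in> {Left_End, Right_End} \<union> Letter ` X \<Longrightarrow> g \<in> work_alphabet M \<Longrightarrow>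
      delta M q a g = Some (q', g', d, e, out) \<Longrightarrow>
      q' \<in> states M \<and> g' \<in> work_alphabet M \<and> length out \<le> k"
    using assms unfolding transducer_over_def by meson
  show ?thesis
  proof (intro exI[of _ k] allI impI)
    fix w C D
    assume w: "w \<in> lists X" and C: "well_formed_config M w C"
      and D: "next_config M w C = Some D"
    obtain q' g' d e out where t:
      "delta M (state C) (input_at w (input_pos C)) (work_tape C (work_pos C)) =
         Some (q', g', d, e, out)"
      and D_eq: "D = \<lparr>state = q', input_pos = min (move_head d (input_pos C)) (length w + 1),
        work_pos = move_head e (work_pos C), work_tape = (work_tape C)(work_pos C := g'),
        output_tape = output_tape C @ out\<rparr>"
      using D by (auto simp: next_config_def)
    have "q' \<in> states M \<and> g' \<in> work_alphabet M \<and> length out \<le> k"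
      using C by (intro k[OF _ input_at_in_cells[OF w] _ t]) (auto simp: well_formed_config_def)
    then show "well_formed_config M w D \<and>
        length (output_tape D) \<le> length (output_tape C) + k"
      using C by (auto simp: D_eq well_formed_config_def)
  qed
qed

lemma initial_config_well_formed:
  assumes "transducer_over X M"
  shows "well_formed_config M w (initial_config M)"
  using assms by (simp add: well_formed_config_def initial_config_def transducer_over_def)

text \<open>
  The right-hand side is \<open>k\<close> times the number of values of \<open>visible_part s\<close>; the factor \<open>length w + 2\<close>
  counts the input positions, end markers included.
\<close>

lemma output_length_le:
  assumes M: "transducer_over X M"
  shows "\<exists>k. \<forall>w v s. w \<in> lists X \<longrightarrow> outputs M w v \<longrightarrow>
    (\<forall>C. reachable M w C \<longrightarrow> work_pos C < s) \<longrightarrow>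
    length v \<le> k * (card (states M) * ((length w + 2) * (s * card (work_alphabet M) ^ s)))"
proof -
  obtain k :: nat where k:
    "\<And>w C D. w \<in> lists X \<Longrightarrow> well_formed_config M w C \<Longrightarrow> next_config M w C = Some D \<Longrightarrow>
       well_formed_config M w D \<and> length (output_tape D) \<le> length (output_tape C) + k"
    using transducer_over_output_bound[OF M] by blast
  show ?thesis
  proof (intro exI[of _ k] allI impI)
    fix w v s
    assume w: "w \<in> lists X" and out: "outputs M w v"
      and space: "\<forall>C. reachable M w C \<longrightarrow> work_pos C < s"
    obtain C where C: "reachable M w C" "next_config M w C = None" "output_tape C = v"
      using out by (auto simp: outputs_def)
    obtain T where "((\<lambda>C D. next_config M w C = Some D) ^^ T) (initial_config M) C"
      using C(1) unfolding reachable_def by (auto dest: rtranclp_imp_relpowp)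
    then obtain run where run0: "run 0 = initial_config M" and runT: "run T = C"
      and run: "\<And>i. i < T \<Longrightarrow> next_config M w (run i) = Some (run (Suc i))"
      unfolding relpowp_fun_conv by blast
    have run_inv: "reachable M w (run i) \<and> well_formed_config M w (run i) \<and>
        length (output_tape (run i)) \<le> k * i" if "i \<le> T" for i
      using that
    proof (induction i)
      case 0
      show ?case
        using initial_config_well_formed[OF M]
        by (simp add: run0 reachable_def) (simp add: initial_config_def)
    next
      case (Suc i)
      then have prev: "reachable M w (run i)" "well_formed_config M w (run i)"
        "length (output_tape (run i)) \<le> k * i" and step: "next_config M w (run i) = Some (run (Suc i))"
        using run by auto
      have "reachable M w (run (Suc i))"
        using prev(1) step unfolding reachable_def by (rule rtranclp.rtrancl_into_rtrancl)
      with k[OF w prev(2) step] prev(3) show ?case by simp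
    qed
    let ?V = "states M \<times> {..length w + 1} \<times> {..<s} \<times> ({..<s} \<rightarrow>\<^sub>E work_alphabet M)"
    have "inj_on (\<lambda>i. visible_part s (run i)) {..T}"
    proof (rule halting_run_visits_distinct_views[where step = "next_config M w"])
      show "next_config M w (run T) = None"
        using C(2) runT by simp
    next
      fix i j
      assume "i \<le> T" and same: "visible_part s (run i) = visible_part s (run j)"
      show "map_option (visible_part s) (next_config M w (run i)) =
          map_option (visible_part s) (next_config M w (run j))"
        using space run_inv[OF \<open>i \<le> T\<close>] by (intro next_config_respects_visible_part[OF same]) auto
    qed (rule run)
    moreover have "(\<lambda>i. visible_part s (run i)) ` {..T} \<subseteq> ?V"
      using run_inv space
      by (auto simp: visible_part_def well_formed_config_def split: if_splits)
    moreover have "finite ?V"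
      using M by (auto simp: transducer_over_def intro!: finite_PiE)
    ultimately have "card {..T} \<le> card ?V"
      by (rule card_inj_on_le)
    also have "card ?V =
        card (states M) * ((length w + 2) * (s * card (work_alphabet M) ^ s))"
      by (simp add: card_cartesian_product card_PiE)
    finally have "T \<le> card (states M) * ((length w + 2) * (s * card (work_alphabet M) ^ s))"
      by simp
    moreover have "length v \<le> k * T"
      using run_inv[of T] runT C(3) by simp
    ultimately show
      "length v \<le> k * (card (states M) * ((length w + 2) * (s * card (work_alphabet M) ^ s)))"
      by (meson le_trans mult_le_mono2)
  qed
qed

section \<open>Logarithmic work space\<close>

text \<open>
  Passing to \<open>n + 2\<close> covers the inputs of length \<open>0\<close> and \<open>1\<close>: there \<open>log 2 n\<close> is \<open>0\<close>
  (for \<open>n = 0\<close> by convention), whereas \<open>log 2 (n + 2)\<close> is always at least \<open>1\<close>.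
\<close>

lemma two_power_log_le:
  fixes c\<^sub>0 :: real
  shows "\<exists>m. \<forall>n s. real s \<le> max 1 (c\<^sub>0 * log 2 (real n)) \<longrightarrow> 2 ^ s \<le> (n + 2) ^ m"
proof (intro exI allI impI)
  let ?m = "nat \<lceil>\<bar>c\<^sub>0\<bar>\<rceil> + 1"
  fix n s :: nat
  assume s: "real s \<le> max 1 (c\<^sub>0 * log 2 (real n))"
  have log_ge: "1 \<le> log 2 (real (n + 2))"
    by (simp add: le_log_iff)
  have log_n: "0 \<le> log 2 (real n) \<and> log 2 (real n) \<le> log 2 (real (n + 2))"
  proof (cases "n = 0")
    case True
    then have "log 2 (real n) = 0"
      by (simp add: log_def)
    with log_ge show ?thesis by simp
  next
    case False
    then show ?thesis
      by (intro conjI) (auto simp del: of_nat_add)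
  qed
  have m: "1 \<le> real ?m" "c\<^sub>0 \<le> real ?m"
    by linarith+
  have "1 \<le> real ?m * log 2 (real (n + 2))"
    using mult_mono[OF m(1) log_ge] m(1) by simp
  moreover have "c\<^sub>0 * log 2 (real n) \<le> real ?m * log 2 (real (n + 2))"
    using m log_n by (intro mult_mono) auto
  ultimately have "real s \<le> real ?m * log 2 (real (n + 2))"
    using s by linarith
  then have "2 powr real s \<le> 2 powr (real ?m * log 2 (real (n + 2)))"
    by simp
  also have "\<dots> = (2 powr log 2 (real (n + 2))) powr real ?m"
    by (simp only: powr_powr mult.commute)
  also have "\<dots> = real (n + 2) powr real ?m"
    by (simp del: of_nat_add)
  also have "\<dots> = real (n + 2) ^ ?m"
    by (rule powr_realpow) simp
  finally have "real (2 ^ s) \<le> real ((n + 2) ^ ?m)"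
    by (simp only: powr_realpow of_nat_power of_nat_numeral zero_less_numeral)
  then show "2 ^ s \<le> (n + 2) ^ ?m"
    by (simp only: of_nat_le_iff)
qed

text \<open>
  The alphabet size \<open>a\<close> is fixed while \<open>s\<close> grows with the input, so \<open>2 ^ s\<close>, which the space
  bound makes polynomial, is the base and \<open>a\<close> moves to the exponent.
\<close>

lemma mult_power_le_two_power:
  fixes a s :: nat
  shows "s * a ^ s \<le> (2 ^ s) ^ Suc a"
proof -
  have "a ^ s \<le> (2 ^ a) ^ s"
    by (intro power_mono) (auto intro: less_imp_le)
  also have "\<dots> = (2 ^ s) ^ a"
    by (simp add: mult.commute flip: power_mult)
  finally show ?thesis
    using mult_le_mono[OF less_imp_le[OF less_exp[of s]]] by simp
qed

theorem logspace_computable_output_polynomial: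
  assumes "logspace_computable X f"
  obtains K c :: nat where "\<And>w. w \<in> lists X \<Longrightarrow> length (f w) \<le> K * (length w + 2) ^ c"
proof -
  obtain M :: "(nat, nat, 'a) transducer" where M: "transducer_over X M"
    and space: "runs_in_logspace X M" and out: "\<And>w. w \<in> lists X \<Longrightarrow> outputs M w (f w)"
    using assms unfolding logspace_computable_def by blast
  obtain c\<^sub>0 :: real where c\<^sub>0: "\<And>w C. w \<in> lists X \<Longrightarrow> reachable M w C \<Longrightarrow>
      real (work_pos C + 1) \<le> max 1 (c\<^sub>0 * log 2 (real (length w)))"
    using space unfolding runs_in_logspace_def by blast
  obtain k :: nat where k: "\<And>w v s. w \<in> lists X \<Longrightarrow> outputs M w v \<Longrightarrow>
       \<forall>C. reachable M w C \<longrightarrow> work_pos C < s \<Longrightarrow>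
       length v \<le> k * (card (states M) * ((length w + 2) * (s * card (work_alphabet M) ^ s)))"
    using output_length_le[OF M] by blast
  obtain m :: nat where
    m: "\<And>n s. real s \<le> max 1 (c\<^sub>0 * log 2 (real n)) \<Longrightarrow> 2 ^ s \<le> (n + 2) ^ m"
    using two_power_log_le by blast
  let ?a = "card (work_alphabet M)"
  show ?thesis
  proof (rule that)
    fix w
    assume w: "w \<in> lists X"
    let ?N = "length w + 2"
    define s where "s = nat \<lfloor>max 1 (c\<^sub>0 * log 2 (real (length w)))\<rfloor>"
    have "work_pos C < s" if "reachable M w C" for C
      using le_nat_floor[OF c\<^sub>0[OF w that]] by (simp add: s_def)
    then have "length (f w) \<le> k * (card (states M) * (?N * (s * ?a ^ s)))"
      using k[OF w out[OF w]] by blast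
    also have "\<dots> \<le> k * (card (states M) * (?N * (?N ^ m) ^ Suc ?a))"
    proof (intro mult_le_mono2)
      have "real s \<le> max 1 (c\<^sub>0 * log 2 (real (length w)))"
        unfolding s_def by (rule of_nat_floor) simp
      then have "2 ^ s \<le> ?N ^ m"
        by (rule m)
      then have "(2 ^ s) ^ Suc ?a \<le> (?N ^ m) ^ Suc ?a"
        by (rule power_mono) simp
      with mult_power_le_two_power show "s * ?a ^ s \<le> (?N ^ m) ^ Suc ?a"
        by (rule le_trans)
    qed
    also have "\<dots> = k * card (states M) * ?N ^ Suc (m * Suc ?a)"
      by (simp only: power_mult power_Suc mult.assoc)
    finally show "length (f w) \<le> k * card (states M) * ?N ^ Suc (m * Suc ?a)" .
  qed
qed

lemma shifted_power_bigo:
  fixes K c :: nat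
  shows "(\<lambda>n. real (K * (n + 2) ^ c)) \<in> O(\<lambda>n. real n ^ c)"
proof (rule bigoI)
  show "\<forall>\<^sub>F n in sequentially. norm (real (K * (n + 2) ^ c)) \<le> real (K * 3 ^ c) * norm (real n ^ c)"
    using eventually_ge_at_top[of "1::nat"]
  proof eventually_elim
    case (elim n)
    then have "(n + 2) ^ c \<le> (3 * n) ^ c"
      by (intro power_mono) auto
    then have "K * (n + 2) ^ c \<le> K * 3 ^ c * n ^ c"
      by (simp add: power_mult_distrib mult.assoc)
    then have "real (K * (n + 2) ^ c) \<le> real (K * 3 ^ c * n ^ c)"
      by (simp only: of_nat_le_iff)
    then show ?case by simp
  qed
qed

theorem proposition12:
  fixes G :: "('a, 'b) monoid_scheme" (structure)
    and X :: "'a set" and L :: "'a list set"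
  assumes "group G"
    and "finite X" and "X \<subseteq> carrier G"
    and "\<forall>x\<in>X. inv x \<in> X"
    and "generate G X = carrier G"
    and "normal_form G X L"
    and "logspace_computable X (normal_form_of G L)"
  shows "\<exists>c::nat. \<exists>g::nat \<Rightarrow> real. g \<in> O(\<lambda>n. real n ^ c) \<and>
           (\<forall>w\<in>lists X. real (length (normal_form_of G L w)) \<le> g (length w))"
proof -
  obtain K c :: nat where "\<And>w. w \<in> lists X \<Longrightarrow>
      length (normal_form_of G L w) \<le> K * (length w + 2) ^ c"
    using logspace_computable_output_polynomial[OF assms(7)] by blast
  then have "\<forall>w\<in>lists X. real (length (normal_form_of G L w)) \<le>
      real (K * (length w + 2) ^ c)"
    by (simp only: of_nat_le_iff) blast
  with shifted_power_bigo[of K c] show ?thesis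
    by (intro exI[of _ c] exI[of _ "\<lambda>n. real (K * (n + 2) ^ c)"]) simp
qed

end
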